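(* Let $R>0$. The penalized estimator $\widehat{\underline{\boldsymbol\beta}}_R^{(j)}$ is, at every output point $\underline{\mathbf t}_j$, $j=1,\dots,m$, a pointwise compromise between some ($R$-dependent) additive fit $(\mathbf P_{\mathbf S,R}\widehat{\underline{\boldsymbol\beta}}_{ll})^{(j)}$ (where $\mathbf P_{\mathbf S,R}\widehat{\underline{\boldsymbol\beta}}_{ll}\in\mathbf F_{\mathrm{add}}$) and the local linear fit $\widehat{\underline{\boldsymbol\beta}}_{ll}^{(j)}$: $$\widehat{\underline{\boldsymbol\beta}}_R^{(j)}=(\mathbf S^{(j)}+R\mathbf I)^{-1}\Big\{R\,(\mathbf P_{\mathbf S,R}\widehat{\underline{\boldsymbol\beta}}_{ll})^{(j)}+\mathbf S^{(j)}\widehat{\underline{\boldsymbol\beta}}_{ll}^{(j)}\Big\}.$$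
   Context: Data $(\underline{\mathbf X}_i,Y_i)\in[0,1]^d\times\mathbb R$, $i=1,\dots,n$; bandwidths $h_1,\dots,h_d>0$; nonnegative kernel weights $K_h(\underline{\mathbf X}_i,\underline{\mathbf x})\ge0$. **Grid and spaces.** The output grid is $\{t^1_1,\dots,t^1_{m_1}\}\times\dots\times\{t^d_1,\dots,t^d_{m_d}\}\subset[0,1]^d$, with its $m=m_1\cdots m_d$ points enumerated as $\underline{\mathbf t}_1,\dots,\underline{\mathbf t}_m$. $\mathbf F_{\mathrm{full}}=\mathbb R^{m(d+1)}$ consists of the stacked vectors $\underline{\boldsymbol\beta}=\mathrm{col}_j(\underline{\boldsymbol\beta}^{(j)})$ with $\underline{\boldsymbol\beta}^{(j)}=(\beta^{(j)}_0,\dots,\beta^{(j)}_d)\in\mathbb R^{d+1}$, with Euclidean norm $\|\cdot\|$; for any $\underline{\mathbf v}\in\mathbf F_{\mathrm{full}}$, $\underline{\mathbf v}^{(j)}$ denotes its block for $\underline{\mathbf t}_j$. $\mathbf F_{\mathrm{add}}\subset\mathbf F_{\mathrm{full}}$ is the subspace of those $\underline{\boldsymbol\beta}$ for which there are functions $r^0,\dots,r^d:[0,1]^d\to\mathbb R$, $r^0$ additive (a sum of functions of single coordinates) and $r^k(\underline{\mathbf x})$ depending only on $x_k$ for $k\ge1$, with $\beta^{(j)}_\ell=r^\ell(\underline{\mathbf t}_j)$ for all $j,\ell$. $\mathbf P_{\mathrm{add}}$ is the orthogonal projection onto $\mathbf F_{\mathrm{add}}$, and $\mathbf Z$ is a real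 matrix with $\mathbf Z^\top\mathbf Z=\mathbf P_{\mathrm{add}}$. **Local linear estimator.** With $u_{i,0}(\underline{\mathbf x})=1$, $u_{i,k}(\underline{\mathbf x})=(X_{i,k}-x_k)/h_k$ for $k\ge1$, let $\mathbf S^{(j)}$ be the $(d+1)\times(d+1)$ matrix with entries $\frac1n\sum_iK_h(\underline{\mathbf X}_i,\underline{\mathbf t}_j)u_{i,\ell}(\underline{\mathbf t}_j)u_{i,l}(\underline{\mathbf t}_j)$, $\underline{\mathbf L}^{(j)}$ the vector with entries $\frac1n\sum_iK_h(\underline{\mathbf X}_i,\underline{\mathbf t}_j)u_{i,\ell}(\underline{\mathbf t}_j)Y_i$ ($\ell,l=0,\dots,d$), $\mathbf S=\mathrm{diag}_j(\mathbf S^{(j)})$ (block-diagonal) and $\underline{\mathbf L}=\mathrm{col}_j(\underline{\mathbf L}^{(j)})$. Let $$SSR(\underline\beta,\underline{\mathbf x})=\frac1n\sum_{i=1}^n\Big(Y_i-\beta_0-\sum_{k=1}^d\beta_k\tfrac{X_{i,k}-x_k}{h_k}\Big)^2K_h(\underline{\mathbf X}_i,\underline{\mathbf x}).$$ $\widehat{\underline{\boldsymbol\beta}}_{ll}=\mathrm{col}_j(\widehat{\underline{\boldsymbol\beta}}_{ll}^{(j)})$ is the local linear estimator: $\widehat{\underline{\boldsymbol\beta}}_{ll}^{(j)}$ minimizes $SSR(\cdot,\underline{\mathbf t}_j)$, equivalently $\mathbf S^{(j)}\widehat{\underline{\boldsymbol\beta}}_{ll}^{(j)}=\underline{\mathbf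 L}^{(j)}$. **Oblique projection.** $\mathbf A_R=R(\mathbf S+R\mathbf I)^{-1}$ and $$\mathbf P_{\mathbf S,R}=\mathbf Z^\top\{(\mathbf I-\mathbf Z\mathbf Z^\top)+\mathbf Z(\mathbf I-\mathbf A_R)\mathbf Z^\top\}^{-}\mathbf Z(\mathbf I-\mathbf A_R),$$ where $\{\cdot\}^-$ denotes any generalized inverse; the matrix in braces equals $\mathbf I-\mathbf Z\mathbf A_R\mathbf Z^\top$. **Penalized estimator.** $$\widehat{\underline{\boldsymbol\beta}}_R=\arg\min_{\underline{\boldsymbol\beta}\in\mathbf F_{\mathrm{full}}}\sum_{j=1}^mSSR(\underline{\boldsymbol\beta}^{(j)},\underline{\mathbf t}_j)+R\|(\mathbf I-\mathbf P_{\mathrm{add}})\underline{\boldsymbol\beta}\|^2,$$ with normal equations $(\mathbf S+R(\mathbf I-\mathbf P_{\mathrm{add}}))\widehat{\underline{\boldsymbol\beta}}_R=\underline{\mathbf L}$, solved by $$\widehat{\underline{\boldsymbol\beta}}_R=(\mathbf I+\mathbf A_R\mathbf Z^\top\{\mathbf I-\mathbf Z\mathbf A_R\mathbf Z^\top\}^{-}\mathbf Z)(\mathbf S+R\mathbf I)^{-1}\underline{\mathbf L}.$$ The minimizer need not be unique; if it is not, $\widehat{\underline{\boldsymbol\beta}}_R$ denotes the one given by this formula, with the same generalized inverse as in $\mathbf P_{\mathbf S,R}$. *)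

theory Defs
  imports "HOL-Analysis.Analysis"
begin

text \<open>
  The coordinates of the covariate space are indexed by the finite type \<open>'d\<close> and the output points
  by the finite type \<open>'m\<close>, so that \<open>d = CARD('d)\<close> and \<open>m = CARD('m)\<close>. The coefficient indices
  \<open>0, 1, \<dots>, d\<close> are the elements of \<open>'d option\<close>: \<open>None\<close> is the index \<open>0\<close> (intercept) and
  \<open>Some k\<close> is the index of the slope in coordinate \<open>k\<close>. The space \<open>F\<^sub>f\<^sub>u\<^sub>l\<^sub>l\<close> of dimension \<open>m(d+1)\<close> is
  \<open>real ^ ('m \<times> 'd option)\<close>.
\<close>

type_synonym ('m, 'd) full_vec = "real ^ ('m \<times> 'd option)"
type_synonym ('m, 'd) full_mat = "real ^ ('m \<times> 'd option) ^ ('m \<times> 'd option)"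

abbreviation unit_cube :: "(real ^ 'd) set" where
  "unit_cube \<equiv> {x. \<forall>k. x $ k \<in> {0..1}}"

definition output_grid :: "('d \<Rightarrow> nat) \<Rightarrow> ('d \<Rightarrow> nat \<Rightarrow> real) \<Rightarrow> (real ^ 'd) set" where
  "output_grid ms t = {x. \<forall>k. x $ k \<in> t k ` {1..ms k}}"

definition block :: "('m::finite, 'd::finite) full_vec \<Rightarrow> 'm \<Rightarrow> real ^ ('d option)" where
  "block v j = (\<chi> l. v $ (j, l))"

definition stack :: "('m::finite \<Rightarrow> real ^ ('d::finite option)) \<Rightarrow> ('m, 'd) full_vec" where
  "stack v = (\<chi> p. v (fst p) $ snd p)"

definition block_diag ::
    "('m::finite \<Rightarrow> real ^ ('d::finite option) ^ ('d option)) \<Rightarrow> ('m, 'd) full_mat" where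
  "block_diag A = (\<chi> p q. if fst p = fst q then A (fst p) $ snd p $ snd q else 0)"

definition additive_on :: "(real ^ 'd::finite) set \<Rightarrow> (real ^ 'd \<Rightarrow> real) \<Rightarrow> bool" where
  "additive_on D r \<longleftrightarrow> (\<exists>g :: 'd \<Rightarrow> real \<Rightarrow> real. \<forall>x\<in>D. r x = (\<Sum>k\<in>UNIV. g k (x $ k)))"

definition depends_only_on_coord :: "(real ^ 'd) set \<Rightarrow> 'd \<Rightarrow> (real ^ 'd \<Rightarrow> real) \<Rightarrow> bool" where
  "depends_only_on_coord D k r \<longleftrightarrow> (\<forall>x\<in>D. \<forall>y\<in>D. x $ k = y $ k \<longrightarrow> r x = r y)"

definition F_add :: "('m::finite \<Rightarrow> real ^ 'd::finite) \<Rightarrow> ('m, 'd) full_vec set" where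
  "F_add pts = {\<beta>. \<exists>r :: 'd option \<Rightarrow> real ^ 'd \<Rightarrow> real.
      additive_on unit_cube (r None) \<and>
      (\<forall>k. depends_only_on_coord unit_cube k (r (Some k))) \<and>
      (\<forall>j l. \<beta> $ (j, l) = r l (pts j))}"

text \<open>The matrix of the orthogonal projection onto a linear subspace \<open>U\<close>.\<close>

definition orth_proj_mat :: "(real ^ 'n::finite) set \<Rightarrow> real ^ 'n ^ 'n" where
  "orth_proj_mat U = matrix (\<lambda>v. THE w. w \<in> U \<and> (\<forall>u\<in>U. orthogonal (v - w) u))"

definition P_add :: "('m::finite \<Rightarrow> real ^ 'd::finite) \<Rightarrow> ('m, 'd) full_mat" where
  "P_add pts = orth_proj_mat (F_add pts)"

definition is_generalized_inverse ::
    "real ^ 'b::finite ^ 'a::finite \<Rightarrow> real ^ 'a ^ 'b \<Rightarrow> bool" where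
  "is_generalized_inverse M G \<longleftrightarrow> M ** G ** M = M"

text \<open>
  Data are \<open>(X i, Y i)\<close> for \<open>i = 1, \<dots>, n\<close>, \<open>h\<close> is the vector of bandwidths, and \<open>K u x\<close> is the
  kernel weight (for these bandwidths) of a data point \<open>u\<close> at the output point \<open>x\<close>.
\<close>

definition regressor :: "real ^ 'd \<Rightarrow> real ^ 'd \<Rightarrow> real ^ 'd \<Rightarrow> 'd option \<Rightarrow> real" where
  "regressor h u x l = (case l of None \<Rightarrow> 1 | Some k \<Rightarrow> (u $ k - x $ k) / h $ k)"

definition SSR :: "nat \<Rightarrow> (nat \<Rightarrow> real ^ 'd::finite) \<Rightarrow> (nat \<Rightarrow> real) \<Rightarrow> real ^ 'd \<Rightarrow>
    (real ^ 'd \<Rightarrow> real ^ 'd \<Rightarrow> real) \<Rightarrow> real ^ ('d option) \<Rightarrow> real ^ 'd \<Rightarrow> real" where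
  "SSR n X Y h K \<beta> x = 1 / real n * (\<Sum>i=1..n.
      (Y i - \<beta> $ None - (\<Sum>k\<in>UNIV. \<beta> $ Some k * ((X i $ k - x $ k) / h $ k)))\<^sup>2 * K (X i) x)"

definition S_loc :: "nat \<Rightarrow> (nat \<Rightarrow> real ^ 'd::finite) \<Rightarrow> real ^ 'd \<Rightarrow>
    (real ^ 'd \<Rightarrow> real ^ 'd \<Rightarrow> real) \<Rightarrow> real ^ 'd \<Rightarrow> real ^ ('d option) ^ ('d option)" where
  "S_loc n X h K x = (\<chi> l l'. 1 / real n *
      (\<Sum>i=1..n. K (X i) x * regressor h (X i) x l * regressor h (X i) x l'))"

definition L_loc :: "nat \<Rightarrow> (nat \<Rightarrow> real ^ 'd::finite) \<Rightarrow> (nat \<Rightarrow> real) \<Rightarrow> real ^ 'd \<Rightarrow>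
    (real ^ 'd \<Rightarrow> real ^ 'd \<Rightarrow> real) \<Rightarrow> real ^ 'd \<Rightarrow> real ^ ('d option)" where
  "L_loc n X Y h K x = (\<chi> l. 1 / real n *
      (\<Sum>i=1..n. K (X i) x * regressor h (X i) x l * Y i))"

definition S_full :: "nat \<Rightarrow> (nat \<Rightarrow> real ^ 'd::finite) \<Rightarrow> real ^ 'd \<Rightarrow>
    (real ^ 'd \<Rightarrow> real ^ 'd \<Rightarrow> real) \<Rightarrow> ('m::finite \<Rightarrow> real ^ 'd) \<Rightarrow> ('m, 'd) full_mat" where
  "S_full n X h K pts = block_diag (\<lambda>j. S_loc n X h K (pts j))"

definition L_full :: "nat \<Rightarrow> (nat \<Rightarrow> real ^ 'd::finite) \<Rightarrow> (nat \<Rightarrow> real) \<Rightarrow> real ^ 'd \<Rightarrow>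
    (real ^ 'd \<Rightarrow> real ^ 'd \<Rightarrow> real) \<Rightarrow> ('m::finite \<Rightarrow> real ^ 'd) \<Rightarrow> ('m, 'd) full_vec" where
  "L_full n X Y h K pts = stack (\<lambda>j. L_loc n X Y h K (pts j))"

definition is_local_linear_estimator :: "nat \<Rightarrow> (nat \<Rightarrow> real ^ 'd::finite) \<Rightarrow> (nat \<Rightarrow> real) \<Rightarrow>
    real ^ 'd \<Rightarrow> (real ^ 'd \<Rightarrow> real ^ 'd \<Rightarrow> real) \<Rightarrow> ('m::finite \<Rightarrow> real ^ 'd) \<Rightarrow>
    ('m, 'd) full_vec \<Rightarrow> bool" where
  "is_local_linear_estimator n X Y h K pts \<beta> \<longleftrightarrow>
      (\<forall>j. is_arg_min (\<lambda>b. SSR n X Y h K b (pts j)) (\<lambda>_. True) (block \<beta> j))"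

definition A_mat :: "real \<Rightarrow> real ^ 'n::finite ^ 'n \<Rightarrow> real ^ 'n ^ 'n" where
  "A_mat R S = R *\<^sub>R matrix_inv (S + R *\<^sub>R mat 1)"

text \<open>The matrix in braces in the oblique projection, and that projection for a choice \<open>G\<close> of a
  generalized inverse of it.\<close>

definition inner_mat :: "real ^ 'n::finite ^ 'p::finite \<Rightarrow> real ^ 'n ^ 'n \<Rightarrow> real ^ 'p ^ 'p" where
  "inner_mat Z A = (mat 1 - Z ** transpose Z) + Z ** (mat 1 - A) ** transpose Z"

definition P_SR ::
    "real ^ 'n::finite ^ 'p::finite \<Rightarrow> real ^ 'p ^ 'p \<Rightarrow> real ^ 'n ^ 'n \<Rightarrow> real \<Rightarrow> real ^ 'n ^ 'n" where
  "P_SR Z G S R = transpose Z ** G ** Z ** (mat 1 - A_mat R S)"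

definition penalized_criterion :: "nat \<Rightarrow> (nat \<Rightarrow> real ^ 'd::finite) \<Rightarrow> (nat \<Rightarrow> real) \<Rightarrow> real ^ 'd \<Rightarrow>
    (real ^ 'd \<Rightarrow> real ^ 'd \<Rightarrow> real) \<Rightarrow> ('m::finite \<Rightarrow> real ^ 'd) \<Rightarrow> real \<Rightarrow>
    ('m, 'd) full_vec \<Rightarrow> real" where
  "penalized_criterion n X Y h K pts R \<beta> =
      (\<Sum>j\<in>UNIV. SSR n X Y h K (block \<beta> j) (pts j)) + R * (norm ((mat 1 - P_add pts) *v \<beta>))\<^sup>2"

definition penalized_formula ::
    "real ^ 'n::finite ^ 'p::finite \<Rightarrow> real ^ 'p ^ 'p \<Rightarrow> real ^ 'n ^ 'n \<Rightarrow> real ^ 'n \<Rightarrow> real \<Rightarrow>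
     real ^ 'n" where
  "penalized_formula Z G S L R =
      (mat 1 + A_mat R S ** transpose Z ** G ** Z) *v (matrix_inv (S + R *\<^sub>R mat 1) *v L)"

text \<open>The penalized estimator is a minimizer of the criterion. If there are several minimizers, it
  is the one given by the closed formula, which depends on the generalized inverse \<open>G\<close>.\<close>

definition is_penalized_estimator :: "nat \<Rightarrow> (nat \<Rightarrow> real ^ 'd::finite) \<Rightarrow> (nat \<Rightarrow> real) \<Rightarrow>
    real ^ 'd \<Rightarrow> (real ^ 'd \<Rightarrow> real ^ 'd \<Rightarrow> real) \<Rightarrow> ('m::finite \<Rightarrow> real ^ 'd) \<Rightarrow> real \<Rightarrow>
    real ^ ('m \<times> 'd option) ^ 'p::finite \<Rightarrow> real ^ 'p ^ 'p \<Rightarrow> ('m, 'd) full_vec \<Rightarrow> bool" where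
  "is_penalized_estimator n X Y h K pts R Z G \<beta> \<longleftrightarrow>
      is_arg_min (penalized_criterion n X Y h K pts R) (\<lambda>_. True) \<beta> \<and>
      ((\<exists>!b. is_arg_min (penalized_criterion n X Y h K pts R) (\<lambda>_. True) b) \<or>
       \<beta> = penalized_formula Z G (S_full n X h K pts) (L_full n X Y h K pts) R)"

end

theory Submission
  imports Defs
begin

text \<open>
  Minimizers of both criteria are characterized by their normal equations. Writing
  \<open>u = (S + R I)\<^sup>-\<^sup>1 L\<close> and \<open>M = I - Z A Z\<^sup>T\<close>, any minimizer \<open>\<beta>\<close> of the penalized criterion satisfies
  \<open>\<beta> = u + A Z\<^sup>T Z \<beta>\<close>, so \<open>Z u = M Z \<beta>\<close> lies in the range of \<open>M\<close> and hence \<open>M G Z u = Z u\<close>. This makes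
  the closed formula a solution of the normal equations too, so that it gives the minimizer in the
  unique case as well. Finally \<open>(I - A) \<beta>\<^sub>l\<^sub>l = u\<close> because \<open>S \<beta>\<^sub>l\<^sub>l = L\<close>, which turns the formula into
  \<open>(S + R I) \<beta>\<^sub>R = R P\<^sub>S\<^sub>,\<^sub>R \<beta>\<^sub>l\<^sub>l + S \<beta>\<^sub>l\<^sub>l\<close>, and this can be read off block by block.
\<close>

section \<open>Quadratic minimization and matrices\<close>

lemma inner_matrix_vector_mult:
  fixes A :: "real ^ 'n::finite ^ 'm::finite"
  shows "x \<bullet> (A *v y) = (transpose A *v x) \<bullet> y"
  by (metis dot_lmul_matrix transpose_matrix_vector)

text \<open>Expanding \<open>f\<close> around \<open>b\<close> leaves a term linear in the residual
  \<open>Q *v b - L\<close> and a nonnegative quadratic term. A zero residual thus makes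
  \<open>b\<close> optimal, and a nonzero one gives a descent direction. \<open>Q\<close> may be
  singular, so the equation describes the whole set of minimizers.\<close>

lemma is_arg_min_quadratic_iff:
  fixes Q :: "real ^ 'n::finite ^ 'n" and f :: "real ^ 'n \<Rightarrow> real"
  assumes f: "\<And>b. f b = b \<bullet> (Q *v b) - 2 * (b \<bullet> L) + c"
    and sym: "transpose Q = Q"
    and psd: "\<And>b. 0 \<le> b \<bullet> (Q *v b)"
  shows "is_arg_min f (\<lambda>_. True) b \<longleftrightarrow> Q *v b = L"
proof -
  have expand: "f (b + w) = f b + 2 * (w \<bullet> (Q *v b - L)) + w \<bullet> (Q *v w)" for w
  proof -
    have "b \<bullet> (Q *v w) = w \<bullet> (Q *v b)"
      by (metis inner_matrix_vector_mult sym inner_commute)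
    then show ?thesis
      by (simp add: f matrix_vector_right_distrib inner_add_left inner_add_right inner_diff_right
          algebra_simps)
  qed
  show ?thesis
  proof
    assume min: "is_arg_min f (\<lambda>_. True) b"
    define r where "r = L - Q *v b"
    \<comment> \<open>Exact line search along \<open>r\<close> would divide by
      \<open>r \<bullet> (Q *v r)\<close>, which may vanish. Adding 1 keeps the quotient defined and
      still bounds \<open>s * (r \<bullet> (Q *v r))\<close> by
      \<open>r \<bullet> r\<close>.\<close>
    define s where "s = (r \<bullet> r) / (r \<bullet> (Q *v r) + 1)"
    have q: "0 \<le> r \<bullet> (Q *v r)" by (rule psd)
    have "f b \<le> f (b + s *\<^sub>R r)"
      using min by (simp add: is_arg_min_linorder)
    also have "\<dots> = f b - 2 * s * (r \<bullet> r) + s * (s * (r \<bullet> (Q *v r)))"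
    proof -
      have "Q *v b - L = - r" by (simp add: r_def)
      then show ?thesis
        by (simp add: expand scaleR_matrix_vector_assoc[symmetric] matrix_vector_mult_scaleR)
    qed
    finally have "2 * s * (r \<bullet> r) \<le> s * (s * (r \<bullet> (Q *v r)))" by simp
    moreover have "s * (r \<bullet> (Q *v r)) \<le> r \<bullet> r"
      using q by (simp add: s_def divide_simps mult_left_mono)
    moreover have "0 \<le> s" using q by (simp add: s_def)
    ultimately have "2 * s * (r \<bullet> r) \<le> s * (r \<bullet> r)"
      by (meson mult_left_mono order_trans)
    then have "s * (r \<bullet> r) \<le> 0" by simp
    then have "(r \<bullet> r) * (r \<bullet> r) \<le> 0"
      using q by (simp add: s_def divide_simps)
    then have "r = 0"
      by (metis inner_eq_zero_iff mult_eq_0_iff order_antisym zero_le_square)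
    then show "Q *v b = L" by (simp add: r_def)
  next
    assume "Q *v b = L"
    then have "f b \<le> f y" for y
      using expand[of "y - b"] psd[of "y - b"] by simp
    then show "is_arg_min f (\<lambda>_. True) b"
      by (simp add: is_arg_min_linorder)
  qed
qed

lemma matrix_vector_mult_add_scaleR_mat1:
  fixes S :: "real ^ 'n::finite ^ 'n"
  shows "(S + R *\<^sub>R mat 1) *v x = S *v x + R *\<^sub>R x"
  by (simp add: matrix_vector_mult_add_rdistrib scaleR_matrix_vector_assoc[symmetric])

lemma matrix_inv_cancel:
  fixes A :: "real ^ 'n::finite ^ 'n"
  assumes "invertible A"
  shows "matrix_inv A *v (A *v x) = x" "A *v (matrix_inv A *v x) = x"
proof -
  have "A ** matrix_inv A = mat 1 \<and> matrix_inv A ** A = mat 1"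
    using assms unfolding invertible_def matrix_inv_def by (rule someI_ex)
  then show "matrix_inv A *v (A *v x) = x" "A *v (matrix_inv A *v x) = x"
    by (simp_all add: matrix_vector_mul_assoc)
qed

text \<open>Pairing an element \<open>x\<close> of the kernel with itself gives
  \<open>R * (x \<bullet> x) \<le> 0\<close>, so the kernel is trivial.\<close>

lemma invertible_psd_add_scaleR:
  fixes S :: "real ^ 'n::finite ^ 'n"
  assumes psd: "\<And>x. 0 \<le> x \<bullet> (S *v x)" and "R > 0"
  shows "invertible (S + R *\<^sub>R mat 1)"
proof -
  have "x = 0" if "(S + R *\<^sub>R mat 1) *v x = 0" for x
  proof -
    have "x \<bullet> (S *v x) + R * (x \<bullet> x) = 0"
      using that by (metis inner_add_right inner_scaleR_right inner_zero_right
          matrix_vector_mult_add_scaleR_mat1)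
    with psd[of x] \<open>R > 0\<close> have "x \<bullet> x \<le> 0"
      by (smt (verit) mult_pos_pos)
    then show "x = 0" by (meson inner_gt_zero_iff not_le)
  qed
  then show ?thesis
    using invertible_left_inverse matrix_left_invertible_ker by blast
qed

section \<open>Orthogonal projection onto the additive vectors\<close>

lemma subspace_F_add: "subspace (F_add pts)"
  unfolding subspace_def
proof (intro conjI ballI allI)
  show "0 \<in> F_add pts"
    unfolding F_add_def additive_on_def depends_only_on_coord_def
    by (auto intro!: exI[of _ "\<lambda>_ _. 0"])
next
  fix v w assume "v \<in> F_add pts" "w \<in> F_add pts"
  then obtain r s g k where r: "\<forall>x\<in>unit_cube. r None x = (\<Sum>i\<in>UNIV. g i (x $ i))"
      "\<forall>i. depends_only_on_coord unit_cube i (r (Some i))" "\<forall>j l. v $ (j, l) = r l (pts j)"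
    and s: "\<forall>x\<in>unit_cube. s None x = (\<Sum>i\<in>UNIV. k i (x $ i))"
      "\<forall>i. depends_only_on_coord unit_cube i (s (Some i))" "\<forall>j l. w $ (j, l) = s l (pts j)"
    unfolding F_add_def additive_on_def by blast
  have "additive_on unit_cube (\<lambda>x. r None x + s None x)"
    unfolding additive_on_def
    by (rule exI[of _ "\<lambda>i y. g i y + k i y"]) (use r(1) s(1) in \<open>simp add: sum.distrib\<close>)
  moreover have "\<forall>i. depends_only_on_coord unit_cube i (\<lambda>x. r (Some i) x + s (Some i) x)"
    using r(2) s(2) unfolding depends_only_on_coord_def
    by (intro allI ballI impI arg_cong2[where f = "(+)"]) blast+
  ultimately show "v + w \<in> F_add pts"
    unfolding F_add_def using r(3) s(3) by (auto intro!: exI[of _ "\<lambda>l x. r l x + s l x"])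
next
  fix c :: real and v assume "v \<in> F_add pts"
  then obtain r g where r: "\<forall>x\<in>unit_cube. r None x = (\<Sum>i\<in>UNIV. g i (x $ i))"
      "\<forall>i. depends_only_on_coord unit_cube i (r (Some i))" "\<forall>j l. v $ (j, l) = r l (pts j)"
    unfolding F_add_def additive_on_def by blast
  have "additive_on unit_cube (\<lambda>x. c * r None x)"
    unfolding additive_on_def
    by (rule exI[of _ "\<lambda>i y. c * g i y"]) (use r(1) in \<open>simp add: sum_distrib_left\<close>)
  moreover have "\<forall>i. depends_only_on_coord unit_cube i (\<lambda>x. c * r (Some i) x)"
    using r(2) unfolding depends_only_on_coord_def
    by (intro allI ballI impI arg_cong2[where f = "(*)"]) blast+
  ultimately show "c *\<^sub>R v \<in> F_add pts"
    unfolding F_add_def using r(3) by (auto intro!: exI[of _ "\<lambda>l x. c * r l x"])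
qed

text \<open>Makes the \<open>THE\<close> in \<open>orth_proj_mat\<close> meaningful. The difference
  of two candidates lies in \<open>U\<close> and is orthogonal to \<open>U\<close>, hence
  vanishes.\<close>

lemma orth_proj_ex1:
  fixes U :: "'a::euclidean_space set"
  assumes U: "subspace U"
  shows "\<exists>!w. w \<in> U \<and> (\<forall>u\<in>U. orthogonal (v - w) u)"
proof -
  obtain y z where yz: "y \<in> U" "\<And>w. w \<in> U \<Longrightarrow> orthogonal z w" "v = y + z"
    using orthogonal_subspace_decomp_exists[of U v] U by (metis span_eq_iff)
  have "w = y" if w: "w \<in> U" "\<forall>u\<in>U. orthogonal (v - w) u" for w
  proof -
    have "y - w \<in> U" using U w(1) yz(1) by (simp add: subspace_diff)
    then have "orthogonal (v - w) (y - w)" "orthogonal z (y - w)" using w(2) yz(2) by auto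
    then have "(y - w) \<bullet> (y - w) = 0"
      by (simp add: yz(3) orthogonal_def inner_diff_left inner_add_left)
    then show "w = y" by simp
  qed
  with yz show ?thesis by (intro ex1I[of _ y]) auto
qed

text \<open>\<open>matrix\<close> represents a map faithfully only if the map is linear. Linearity
  follows from uniqueness: sums and multiples of projections have the properties that define the
  projections of sums and multiples.\<close>

lemma orth_proj_mat_works:
  fixes U :: "(real ^ 'n::finite) set"
  assumes U: "subspace U"
  shows "orth_proj_mat U *v v \<in> U"
    and "\<And>u. u \<in> U \<Longrightarrow> orthogonal (v - orth_proj_mat U *v v) u"
proof -
  define p where "p v = (THE w. w \<in> U \<and> (\<forall>u\<in>U. orthogonal (v - w) u))" for v
  have p: "p v \<in> U" "\<And>u. u \<in> U \<Longrightarrow> orthogonal (v - p v) u" for v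
    using theI'[OF orth_proj_ex1[OF U, of v]] unfolding p_def by blast+
  have p_eq: "p v = w" if "w \<in> U" "\<And>u. u \<in> U \<Longrightarrow> orthogonal (v - w) u" for v w
    using orth_proj_ex1[OF U, of v] p(1)[of v] p(2)[of _ v] that by blast
  have "linear p"
  proof (rule linearI)
    show "p (x + y) = p x + p y" for x y
    proof (rule p_eq)
      show "p x + p y \<in> U" using p(1) U by (simp add: subspace_add)
      show "orthogonal (x + y - (p x + p y)) u" if "u \<in> U" for u
        using p(2)[OF that, of x] p(2)[OF that, of y]
        by (simp add: orthogonal_def inner_diff_left inner_add_left)
    qed
    show "p (c *\<^sub>R x) = c *\<^sub>R p x" for c x
    proof (rule p_eq)
      show "c *\<^sub>R p x \<in> U" using p(1) U by (simp add: subspace_scale)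
      show "orthogonal (c *\<^sub>R x - c *\<^sub>R p x) u" if "u \<in> U" for u
        using p(2)[OF that, of x]
        by (simp add: orthogonal_def inner_diff_left)
    qed
  qed
  moreover have "orth_proj_mat U = matrix p"
    unfolding orth_proj_mat_def p_def ..
  ultimately have "orth_proj_mat U *v v = p v" for v
    by simp
  then show "orth_proj_mat U *v v \<in> U" "\<And>u. u \<in> U \<Longrightarrow> orthogonal (v - orth_proj_mat U *v v) u"
    using p by simp_all
qed

lemma orth_proj_mat_fixes:
  assumes U: "subspace U" and "v \<in> U"
  shows "orth_proj_mat U *v v = v"
proof -
  have "\<forall>u\<in>U. orthogonal (v - v) u" by (simp add: orthogonal_def)
  with orth_proj_ex1[OF U, of v] orth_proj_mat_works[OF U, where v = v] \<open>v \<in> U\<close>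
  show ?thesis by blast
qed

text \<open>The range of \<open>Z^T\<close> is that of \<open>Z^T Z\<close>. The part
  \<open>x\<close> of \<open>Z^T w\<close> orthogonal to \<open>U\<close> satisfies
  \<open>|Z x|^2 = x \<bullet> P x = 0\<close>. So \<open>x\<close> is orthogonal to
  \<open>Z^T w\<close> as well as to its projection, hence to their difference, which is
  \<open>x\<close> itself.\<close>

lemma transpose_factor_orth_proj_in_subspace:
  fixes Z :: "real ^ 'n::finite ^ 'p::finite"
  assumes U: "subspace U" and Z: "transpose Z ** Z = orth_proj_mat U"
  shows "transpose Z *v w \<in> U"
proof -
  let ?P = "orth_proj_mat U"
  define x where "x = transpose Z *v w - ?P *v (transpose Z *v w)"
  have "?P *v x = 0"
    using orth_proj_mat_fixes[OF U orth_proj_mat_works(1)[OF U]]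
    by (simp add: x_def matrix_vector_mult_diff_distrib)
  then have "(Z *v x) \<bullet> (Z *v x) = 0"
    by (metis Z inner_matrix_vector_mult inner_zero_left matrix_vector_mul_assoc)
  then have "Z *v x = 0" by simp
  then have "x \<bullet> (transpose Z *v w) = 0"
    by (simp only: inner_matrix_vector_mult transpose_transpose inner_zero_left)
  moreover have "x \<bullet> (?P *v (transpose Z *v w)) = 0"
    using orth_proj_mat_works[OF U] unfolding x_def orthogonal_def by blast
  ultimately have "x \<bullet> x = 0"
    using inner_diff_right[of x] unfolding x_def by (metis diff_self)
  then have "transpose Z *v w = ?P *v (transpose Z *v w)" by (simp add: x_def)
  then show ?thesis using orth_proj_mat_works(1)[OF U] by metis
qed

section \<open>Block structure and least squares criteria\<close>

lemma inner_eq_sum_block: "x \<bullet> y = (\<Sum>j\<in>UNIV. block x j \<bullet> block y j)"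
  by (simp add: inner_vec_def block_def sum.cartesian_product flip: UNIV_Times_UNIV)

lemma block_stack [simp]: "block (stack v) j = v j"
  by (simp add: block_def stack_def vec_eq_iff)

lemma block_eqI: "(\<And>j. block x j = block y j) \<Longrightarrow> x = y"
  by (auto simp: block_def vec_eq_iff)

lemma block_add [simp]: "block (x + y) j = block x j + block y j"
  by (simp add: block_def vec_eq_iff)

lemma block_scaleR [simp]: "block (c *\<^sub>R x) j = c *\<^sub>R block x j"
  by (simp add: block_def vec_eq_iff)

lemma block_block_diag [simp]: "block (block_diag A *v x) j = A j *v block x j"
proof -
  have "(\<Sum>q\<in>UNIV. (if j = fst q then A j $ l $ snd q else 0) * x $ q)
      = (\<Sum>l'\<in>UNIV. A j $ l $ l' * x $ (j, l'))" for l
  proof -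
    have "(\<Sum>q\<in>UNIV. (if j = fst q then A j $ l $ snd q else 0) * x $ q)
        = (\<Sum>i\<in>UNIV. \<Sum>l'\<in>UNIV. (if j = i then A j $ l $ l' else 0) * x $ (i, l'))"
      by (simp add: sum.cartesian_product case_prod_beta flip: UNIV_Times_UNIV)
    also have "\<dots> = (\<Sum>i\<in>UNIV. if j = i then \<Sum>l'\<in>UNIV. A j $ l $ l' * x $ (i, l') else 0)"
      by (intro sum.cong) auto
    finally show ?thesis by simp
  qed
  then show ?thesis
    by (simp add: block_def block_diag_def matrix_vector_mult_def vec_eq_iff cong: if_cong)
qed

lemma transpose_block_diag: "transpose (block_diag A) = block_diag (\<lambda>j. transpose (A j))"
  by (simp add: transpose_def block_diag_def vec_eq_iff)

section \<open>Local least squares as a quadratic form\<close>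

definition regressor_vec :: "real ^ 'd::finite \<Rightarrow> real ^ 'd \<Rightarrow> real ^ 'd \<Rightarrow> real ^ ('d option)" where
  "regressor_vec h u x = (\<chi> l. regressor h u x l)"

lemma inner_regressor_vec:
  "b \<bullet> regressor_vec h u x = b $ None + (\<Sum>k\<in>UNIV. b $ Some k * ((u $ k - x $ k) / h $ k))"
  by (simp add: regressor_vec_def inner_vec_def regressor_def UNIV_option_conv sum.reindex)

text \<open>\<open>S_loc\<close> is \<open>1/n\<close> times a weighted sum of rank-one matrices
  \<open>g g^T\<close> with \<open>g\<close> a regressor vector. For \<open>b = c\<close> the
  summands become weighted squares, which serves both the expansion of \<open>SSR\<close> and
  semidefiniteness.\<close>

lemma inner_S_loc:
  "b \<bullet> (S_loc n X h K x *v c) = 1 / real n *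
    (\<Sum>i=1..n. K (X i) x * (b \<bullet> regressor_vec h (X i) x) * (c \<bullet> regressor_vec h (X i) x))"
proof -
  let ?g = "\<lambda>i. regressor_vec h (X i) x"
  have "S_loc n X h K x *v c = (1 / real n) *\<^sub>R (\<Sum>i=1..n. (K (X i) x * (c \<bullet> ?g i)) *\<^sub>R ?g i)"
  proof (simp only: vec_eq_iff, rule allI)
    fix l
    have "(S_loc n X h K x *v c) $ l = (\<Sum>l'\<in>UNIV. 1 / real n *
        (\<Sum>i=1..n. K (X i) x * ?g i $ l * ?g i $ l' * c $ l'))"
      by (simp add: S_loc_def matrix_vector_mult_def regressor_vec_def sum_distrib_right mult.assoc)
    also have "\<dots> = 1 / real n * (\<Sum>i=1..n. \<Sum>l'\<in>UNIV. K (X i) x * ?g i $ l * ?g i $ l' * c $ l')"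
      by (simp only: sum_distrib_left[symmetric] sum.swap[of _ "{1..n}"])
    also have "\<dots> = ((1 / real n) *\<^sub>R (\<Sum>i=1..n. (K (X i) x * (c \<bullet> ?g i)) *\<^sub>R ?g i)) $ l"
      by (simp add: inner_vec_def sum_distrib_left sum_distrib_right mult_ac)
    finally show "(S_loc n X h K x *v c) $ l = \<dots>" .
  qed
  then show ?thesis
    by (simp add: inner_sum_right mult_ac)
qed

lemma inner_L_loc:
  "b \<bullet> L_loc n X Y h K x = 1 / real n * (\<Sum>i=1..n. K (X i) x * (b \<bullet> regressor_vec h (X i) x) * Y i)"
proof -
  have "L_loc n X Y h K x = (1 / real n) *\<^sub>R (\<Sum>i=1..n. (K (X i) x * Y i) *\<^sub>R regressor_vec h (X i) x)"
    by (simp add: vec_eq_iff L_loc_def regressor_vec_def mult_ac)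
  then show ?thesis
    by (simp add: inner_sum_right mult_ac)
qed

text \<open>Brings \<open>SSR\<close> into the shape required by
  \<open>is_arg_min_quadratic_iff\<close>; the last term is constant in \<open>b\<close>.\<close>

lemma SSR_eq_quadratic:
  "SSR n X Y h K b x = b \<bullet> (S_loc n X h K x *v b) - 2 * (b \<bullet> L_loc n X Y h K x)
    + 1 / real n * (\<Sum>i=1..n. K (X i) x * (Y i)\<^sup>2)"
proof -
  let ?g = "\<lambda>i. b \<bullet> regressor_vec h (X i) x"
  have "SSR n X Y h K b x = 1 / real n * (\<Sum>i=1..n. (Y i - ?g i)\<^sup>2 * K (X i) x)"
    by (simp add: SSR_def inner_regressor_vec diff_diff_eq)
  also have "(\<Sum>i=1..n. (Y i - ?g i)\<^sup>2 * K (X i) x) = (\<Sum>i=1..n. K (X i) x * ?g i * ?g i)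
      - 2 * (\<Sum>i=1..n. K (X i) x * ?g i * Y i) + (\<Sum>i=1..n. K (X i) x * (Y i)\<^sup>2)"
    unfolding sum_distrib_left sum_subtractf[symmetric] sum.distrib[symmetric]
    by (intro sum.cong) (simp_all add: power2_eq_square algebra_simps)
  finally show ?thesis
    by (simp only: inner_S_loc inner_L_loc distrib_left right_diff_distrib mult.left_commute)
qed

lemma transpose_S_loc: "transpose (S_loc n X h K x) = S_loc n X h K x"
  by (simp add: S_loc_def transpose_def vec_eq_iff mult_ac)

lemma S_loc_psd:
  assumes "\<And>i. i \<in> {1..n} \<Longrightarrow> 0 \<le> K (X i) x"
  shows "0 \<le> b \<bullet> (S_loc n X h K x *v b)"
  unfolding inner_S_loc mult.assoc
  using assms by (intro mult_nonneg_nonneg[OF _ sum_nonneg] mult_nonneg_nonneg[OF _ zero_le_square]) auto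

section \<open>The closed formula\<close>

text \<open>\<open>Z ** transpose Z\<close> enters \<open>inner_mat\<close> with both signs and
  cancels.\<close>

lemma inner_mat_mult_vec:
  "inner_mat Z A *v w = w - Z *v (A *v (transpose Z *v w))"
  by (simp add: inner_mat_def matrix_vector_mult_add_rdistrib matrix_vector_mult_diff_rdistrib
      matrix_vector_mult_diff_distrib flip: matrix_vector_mul_assoc)

lemma A_mat_mult_vec: "A_mat R S *v v = R *\<^sub>R (matrix_inv (S + R *\<^sub>R mat 1) *v v)"
  by (simp add: A_mat_def scaleR_matrix_vector_assoc)

text \<open>Since \<open>A = R (S + R I)^-1\<close>, the inverse is a left factor of the whole
  formula and is removed by the multiplication.\<close>

lemma penalized_formula_eq:
  assumes inv: "invertible (S + R *\<^sub>R mat 1)"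
  shows "(S + R *\<^sub>R mat 1) *v penalized_formula Z G S L R
    = L + R *\<^sub>R (transpose Z *v (G *v (Z *v (matrix_inv (S + R *\<^sub>R mat 1) *v L))))"
proof -
  have "penalized_formula Z G S L R = matrix_inv (S + R *\<^sub>R mat 1) *v
      (L + R *\<^sub>R (transpose Z *v (G *v (Z *v (matrix_inv (S + R *\<^sub>R mat 1) *v L)))))"
    by (simp add: penalized_formula_def matrix_vector_mult_add_rdistrib A_mat_mult_vec
        matrix_vector_right_distrib matrix_vector_mult_scaleR flip: matrix_vector_mul_assoc)
  then show ?thesis by (simp add: matrix_inv_cancel[OF inv])
qed

text \<open>Identifies the correction term in \<open>penalized_formula_eq\<close> with the oblique
  projection of a local linear fit.\<close>

lemma P_SR_solution:
  assumes inv: "invertible (S + R *\<^sub>R mat 1)" and b: "S *v b = L"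
  shows "P_SR Z G S R *v b
    = transpose Z *v (G *v (Z *v (matrix_inv (S + R *\<^sub>R mat 1) *v L)))"
proof -
  \<comment> \<open>\<open>S *v b = L\<close> becomes a fixed-point equation whose second part is
    \<open>A_mat R S *v b\<close>.\<close>
  have "b = matrix_inv (S + R *\<^sub>R mat 1) *v (L + R *\<^sub>R b)"
    using matrix_inv_cancel(1)[OF inv, of b] b by (simp add: matrix_vector_mult_add_scaleR_mat1)
  then have "b - A_mat R S *v b = matrix_inv (S + R *\<^sub>R mat 1) *v L"
    by (simp add: A_mat_mult_vec matrix_vector_right_distrib matrix_vector_mult_scaleR
        add_implies_diff[symmetric] diff_eq_eq)
  then show ?thesis
    by (simp add: P_SR_def matrix_vector_mult_diff_rdistrib flip: matrix_vector_mul_assoc)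
qed

text \<open>The solution \<open>b\<close> serves as a witness that the system with matrix
  \<open>?M\<close> and right-hand side \<open>Z *v (?I *v L)\<close> is solvable; any generalized
  inverse returns a solution of a solvable system.\<close>

lemma penalized_formula_normal_equations:
  fixes Z :: "real ^ 'n::finite ^ 'p::finite"
  assumes inv: "invertible (S + R *\<^sub>R mat 1)"
    and G: "is_generalized_inverse (inner_mat Z (A_mat R S)) G"
    and b: "S *v b + R *\<^sub>R (b - (transpose Z ** Z) *v b) = L"
  defines "f \<equiv> penalized_formula Z G S L R"
  shows "S *v f + R *\<^sub>R (f - (transpose Z ** Z) *v f) = L"
proof -
  let ?I = "matrix_inv (S + R *\<^sub>R mat 1)" and ?M = "inner_mat Z (A_mat R S)"
  have solve: "x = ?I *v L + A_mat R S *v (transpose Z *v w)"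
    if "(S + R *\<^sub>R mat 1) *v x = L + R *\<^sub>R (transpose Z *v w)" for x w
    using matrix_inv_cancel(1)[OF inv, of x] that
    by (simp add: A_mat_mult_vec matrix_vector_right_distrib matrix_vector_mult_scaleR)
  have "(S + R *\<^sub>R mat 1) *v b = L + R *\<^sub>R (transpose Z *v (Z *v b))"
    unfolding matrix_vector_mult_add_scaleR_mat1 matrix_vector_mul_assoc b[symmetric]
    by (simp add: scaleR_diff_right)
  from arg_cong[OF solve[OF this], of "(*v) Z"]
  have range: "?M *v (Z *v b) = Z *v (?I *v L)"
    by (simp add: inner_mat_mult_vec matrix_vector_right_distrib diff_eq_eq)
  define w where "w = G *v (Z *v (?I *v L))"
  have "?M *v w = ?M *v (G *v (?M *v (Z *v b)))" by (simp add: w_def range)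
  also have "\<dots> = ?M *v (Z *v b)"
    using G by (simp add: is_generalized_inverse_def matrix_vector_mul_assoc matrix_mul_assoc)
  also have "\<dots> = Z *v (?I *v L)" by (rule range)
  finally have w: "w = Z *v (?I *v L) + Z *v (A_mat R S *v (transpose Z *v w))"
    by (simp add: inner_mat_mult_vec diff_eq_eq)
  have f: "(S + R *\<^sub>R mat 1) *v f = L + R *\<^sub>R (transpose Z *v w)"
    unfolding f_def w_def by (rule penalized_formula_eq[OF inv])
  \<comment> \<open>Both sides equal
    \<open>Z *v (?I *v L) + Z *v (A_mat R S *v (transpose Z *v w))\<close>.\<close>
  have "Z *v f = w"
    using arg_cong[OF solve[OF f], of "(*v) Z"] w by (simp add: matrix_vector_right_distrib)
  then have "(transpose Z ** Z) *v f = transpose Z *v w"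
    by (metis matrix_vector_mul_assoc)
  with f show ?thesis
    unfolding matrix_vector_mult_add_scaleR_mat1
    by (simp add: scaleR_diff_right add_diff_eq)
qed

text \<open>The penalty is the quadratic form of \<open>R (I - P)\<close>, so the criterion is
  quadratic with matrix \<open>Q = S + R (I - P)\<close>.\<close>

lemma penalized_criterion_arg_min_iff:
  fixes Z :: "real ^ ('m::finite \<times> 'd::finite option) ^ 'p::finite"
  assumes K: "\<And>i j. i \<in> {1..n} \<Longrightarrow> 0 \<le> K (X i) (pts j)"
    and Z: "transpose Z ** Z = P_add pts" and "R > 0"
  shows "is_arg_min (penalized_criterion n X Y h K pts R) (\<lambda>_. True) b \<longleftrightarrow>
    S_full n X h K pts *v b + R *\<^sub>R (b - (transpose Z ** Z) *v b) = L_full n X Y h K pts"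
proof -
  let ?S = "S_full n X h K pts" and ?P = "P_add pts"
  define Q where "Q = ?S + R *\<^sub>R (mat 1 - ?P)"
  have Q: "Q *v x = ?S *v x + R *\<^sub>R (x - ?P *v x)" for x
    by (simp add: Q_def matrix_vector_mult_add_rdistrib matrix_vector_mult_diff_rdistrib
        scaleR_matrix_vector_assoc[symmetric])
  have symP: "transpose ?P = ?P"
    by (simp add: matrix_transpose_mul flip: Z)
  have "orthogonal (x - ?P *v x) (?P *v x)" for x
    unfolding P_add_def by (intro orth_proj_mat_works subspace_F_add)
  \<comment> \<open>As \<open>x - P x\<close> is orthogonal to \<open>P x\<close>, one factor of the
    squared norm may be replaced by \<open>x\<close>.\<close>
  then have normP: "x \<bullet> (x - ?P *v x) = (norm ((mat 1 - ?P) *v x))\<^sup>2" for x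
    by (simp add: power2_norm_eq_inner matrix_vector_mult_diff_rdistrib orthogonal_def
        inner_diff_left inner_diff_right inner_commute)
  have S: "x \<bullet> (?S *v x) = (\<Sum>j\<in>UNIV. block x j \<bullet> (S_loc n X h K (pts j) *v block x j))" for x
    by (simp add: inner_eq_sum_block S_full_def)
  have "0 \<le> x \<bullet> (?S *v x)" for x
    unfolding S by (intro sum_nonneg S_loc_psd K)
  then have psd: "0 \<le> x \<bullet> (Q *v x)" for x
    using \<open>R > 0\<close> by (simp add: Q inner_add_right normP)
  have symQ: "transpose Q = Q"
  proof -
    have "transpose ?S = ?S" by (simp add: S_full_def transpose_block_diag transpose_S_loc)
    with symP show ?thesis by (auto simp: Q_def transpose_def vec_eq_iff mat_def)
  qed
  have "is_arg_min (penalized_criterion n X Y h K pts R) (\<lambda>_. True) b \<longleftrightarrow>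
      Q *v b = L_full n X Y h K pts"
  proof (rule is_arg_min_quadratic_iff[OF _ symQ psd])
    fix x
    show "penalized_criterion n X Y h K pts R x = x \<bullet> (Q *v x) - 2 * (x \<bullet> L_full n X Y h K pts)
        + (\<Sum>j\<in>UNIV. 1 / real n * (\<Sum>i=1..n. K (X i) (pts j) * (Y i)\<^sup>2))"
      by (simp add: penalized_criterion_def Q inner_add_right normP S SSR_eq_quadratic
          sum.distrib sum_subtractf L_full_def inner_eq_sum_block[of x "stack _"] sum_distrib_left)
  qed
  then show ?thesis by (simp add: Q Z)
qed

theorem proposition1:
  fixes n :: nat
    and X :: "nat \<Rightarrow> real ^ 'd::finite"
    and Y :: "nat \<Rightarrow> real"
    and h :: "real ^ 'd"
    and K :: "real ^ 'd \<Rightarrow> real ^ 'd \<Rightarrow> real"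
    and ms :: "'d \<Rightarrow> nat"
    and t :: "'d \<Rightarrow> nat \<Rightarrow> real"
    and pts :: "'m::finite \<Rightarrow> real ^ 'd"
    and Z :: "real ^ ('m \<times> 'd option) ^ 'p::finite"
    and G :: "real ^ 'p ^ 'p"
    and R :: real
    and \<beta>_ll \<beta>_R :: "('m, 'd) full_vec"
  assumes "n \<ge> 1"
    and "\<And>i. i \<in> {1..n} \<Longrightarrow> X i \<in> unit_cube"
    and "\<And>k. h $ k > 0"
    and "\<And>i x. i \<in> {1..n} \<Longrightarrow> x \<in> unit_cube \<Longrightarrow> K (X i) x \<ge> 0"
    and "\<And>k. ms k \<ge> 1"
    and "\<And>k. inj_on (t k) {1..ms k}"
    and "\<And>k i. i \<in> {1..ms k} \<Longrightarrow> t k i \<in> {0..1}"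
    and "bij_betw pts UNIV (output_grid ms t)"
    and "transpose Z ** Z = P_add pts"
    and "R > 0"
    and "is_generalized_inverse (inner_mat Z (A_mat R (S_full n X h K pts))) G"
    and "is_local_linear_estimator n X Y h K pts \<beta>_ll"
    and "is_penalized_estimator n X Y h K pts R Z G \<beta>_R"
  shows "P_SR Z G (S_full n X h K pts) R *v \<beta>_ll \<in> F_add pts \<and>
    (\<forall>j. block \<beta>_R j =
      matrix_inv (S_loc n X h K (pts j) + R *\<^sub>R mat 1) *v
        (R *\<^sub>R block (P_SR Z G (S_full n X h K pts) R *v \<beta>_ll) j
          + S_loc n X h K (pts j) *v block \<beta>_ll j))"
proof -
  let ?S = "S_full n X h K pts" and ?L = "L_full n X Y h K pts"
  let ?Sj = "\<lambda>j. S_loc n X h K (pts j)"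
  \<comment> \<open>Kernel weights are nonnegative at points of the unit cube, so the output points
    are first placed there.\<close>
  have "pts j $ k \<in> {0..1}" for j k
  proof -
    have "pts j \<in> output_grid ms t" using bij_betwE[OF assms(8)] by blast
    then obtain i where "i \<in> {1..ms k}" "pts j $ k = t k i" unfolding output_grid_def by blast
    then show ?thesis using assms(7) by metis
  qed
  then have K: "\<And>i j. i \<in> {1..n} \<Longrightarrow> 0 \<le> K (X i) (pts j)"
    using assms(4) by blast
  have psd_loc: "0 \<le> b \<bullet> (?Sj j *v b)" for j b
    by (intro S_loc_psd K)
  have inv_loc: "invertible (?Sj j + R *\<^sub>R mat 1)" for j
    by (intro invertible_psd_add_scaleR psd_loc \<open>R > 0\<close>)
  have inv: "invertible (?S + R *\<^sub>R mat 1)"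
    by (intro invertible_psd_add_scaleR \<open>R > 0\<close>)
      (simp add: inner_eq_sum_block S_full_def sum_nonneg psd_loc)
  have "?Sj j *v block \<beta>_ll j = L_loc n X Y h K (pts j)" for j
    using assms(12) is_arg_min_quadratic_iff[OF SSR_eq_quadratic transpose_S_loc psd_loc]
    unfolding is_local_linear_estimator_def by blast
  then have ll: "?S *v \<beta>_ll = ?L"
    by (intro block_eqI) (simp add: S_full_def L_full_def)
  have crit: "is_arg_min (penalized_criterion n X Y h K pts R) (\<lambda>_. True) b \<longleftrightarrow>
      ?S *v b + R *\<^sub>R (b - (transpose Z ** Z) *v b) = ?L" for b
    by (intro penalized_criterion_arg_min_iff K assms(9) \<open>R > 0\<close>)
  have min: "is_arg_min (penalized_criterion n X Y h K pts R) (\<lambda>_. True) \<beta>_R"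
    using assms(13) unfolding is_penalized_estimator_def by blast
  \<comment> \<open>Knowing that the formula also gives a minimizer settles the case of a unique
    minimizer; otherwise the estimator equals the formula by definition.\<close>
  then have "is_arg_min (penalized_criterion n X Y h K pts R) (\<lambda>_. True)
      (penalized_formula Z G ?S ?L R)"
    unfolding crit by (rule penalized_formula_normal_equations[OF inv assms(11)])
  with min have formula: "\<beta>_R = penalized_formula Z G ?S ?L R"
    using assms(13) unfolding is_penalized_estimator_def by blast
  have "P_SR Z G ?S R *v \<beta>_ll \<in> F_add pts"
    unfolding P_SR_solution[OF inv ll]
    by (intro transpose_factor_orth_proj_in_subspace subspace_F_add)
      (simp add: assms(9) P_add_def)
  moreover have eq: "(?S + R *\<^sub>R mat 1) *v \<beta>_R = R *\<^sub>R (P_SR Z G ?S R *v \<beta>_ll) + ?S *v \<beta>_ll"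
    by (simp add: formula penalized_formula_eq[OF inv] P_SR_solution[OF inv ll] ll)
  \<comment> \<open>\<open>S\<close> is block diagonal, so the global equation splits into one
    equation for each output point.\<close>
  have "(?Sj j + R *\<^sub>R mat 1) *v block \<beta>_R j
      = R *\<^sub>R block (P_SR Z G ?S R *v \<beta>_ll) j + ?Sj j *v block \<beta>_ll j" for j
    using arg_cong[OF eq, of "\<lambda>v. block v j"]
    by (simp add: matrix_vector_mult_add_scaleR_mat1 S_full_def)
  then have "block \<beta>_R j = matrix_inv (?Sj j + R *\<^sub>R mat 1) *v
      (R *\<^sub>R block (P_SR Z G ?S R *v \<beta>_ll) j + ?Sj j *v block \<beta>_ll j)" for j
    by (metis matrix_inv_cancel(1)[OF inv_loc])
  ultimately show ?thesis by blast
qed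

end
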